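(* Let $\Sigma$ be a finite alphabet and $e,f\in\mathrm{RegE}(\Sigma)$. If Duplicator has a winning strategy in the simulation game from the position $(\emptyset\mid\{e\}\vdash f)$, then $e\le f$ is derivable in $\mathsf{SRKAM}$.
   Context: $\mathrm{RegE}(\Sigma)$ is the set of expressions generated by $e::=a\ (a\in\Sigma)\mid0\mid\top\mid1\mid e\sqcup e\mid e\sqcap e\mid e\star e\mid e^\diamond$. $\mathsf{SRKAM}$: $e\le f$ is derivable if obtained from reflexivity $a\le a$ and the following axiom schemes / Horn rules, for arbitrary expressions $a,b,c,a',b'$ ($a=b$ abbreviates both inequalities): $a\le b\wedge b\le c\Rightarrow a\le c$; $0\le a$; $a\le\top$; $a\le a\sqcup b$; $b\le a\sqcup b$; $b\le a\wedge c\le a\Rightarrow b\sqcup c\le a$; $a\sqcap b\le a$; $a\sqcap b\le b$; $a\le b\wedge a\le c\Rightarrow a\le b\sqcap c$; $a\sqcap(b\sqcup c)\le(a\sqcap b)\sqcup(a\sqcap c)$; $a\star1=a=1\star a$; $a\star(b\star c)=(a\star b)\star c$; $a\le a'\wedge b\le b'\Rightarrow a\star b\le a'\star b'$; $a\star0\le0$; $\top\le a\star\top$; $a\star(b\sqcup c)\le(a\star b)\sqcup(a\star c)$; $(a\star b)\sqcap(a\star c)\le a\star(b\sqcap c)$; $(a\star b)\sqcap c\le(a\sqcap c)\star b$; $1\le a^\diamond$; $a^\diamond\star a\le a^\diamond$; $a\sqcap(b\star c)\le b\Rightarrow a\sqcap(b\star c^\diamond)\le b$. Simulation game. Transitions $\to$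 on expressions: least relation with $e\sqcup f\to e$, $e\sqcup f\to f$, $e\sqcap f\to e$, $e\sqcap f\to f$, $a\to1$ ($a\in\Sigma$), $e\star1\to e$, $e^\diamond\to1$, $e^\diamond\to e^\diamond\star e$, and $g\star e\to g\star f$ whenever $e\to f$. Polarity: $\mathrm{pol}(e\star f)=\mathrm{pol}(f)$; $\exists$ for $e\sqcup f$, $1$, $0$, $e^\diamond$; $\forall$ for $e\sqcap f$, $\top$; $?a$ for a letter $a$. Positions $(\Gamma\mid X\vdash e)$ with $\Gamma\subseteq\Sigma$, $X$ a finite set of expressions, $e$ an expression. Position polarity: $\forall$ if some $t\in X\setminus\{1\}$ has polarity in $\{\exists,\forall\}$; else $\mathrm{pol}(e)$ if in $\{\exists,\forall\}$; else $\exists$. Moves ($X\uplus\{t\}$ means $t\notin X$): EXPLORE $(\Gamma\mid X\uplus\{t\}\vdash e)\to(\Gamma\mid X\cup\{t'\}\vdash e)$ if $\mathrm{pol}(t)=\exists$, $t\to t'$; FORK $(\Gamma\mid X\uplus\{t\}\vdash e)\to(\Gamma\mid X\cup\{t':t\to t'\}\vdash e)$ if $\mathrm{pol}(t)=\forall$; ALEA $(\Gamma\mid X\vdash e)\to(\Gamma\mid X\vdash e')$ if $\mathrm{pol}(e)=\forall$, all elements of $X$ of polarity $\exists$ or $\forall$ equal $1$, $e\to e'$; CHOOSE $(\Gamma\mid X\vdash e)\to(\Gamma\mid X\vdash e')$ if position and $e$ have polarity $\exists$, $e\to e'$; JUNK $(\Gamma\mid X\vdash e)\to(\Gamma\mid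 X\vdash e')$ if position polarity $\exists$, $\mathrm{pol}(e)=?a$, $a\in\Gamma$, $e\to e'$; FILL $(\Gamma\mid X\uplus\{t\}\vdash e)\to(\Gamma\cup\{a\}\mid X\cup\{t'\}\vdash e')$ if position polarity $\exists$, $\mathrm{pol}(e)=\mathrm{pol}(t)=?a$, $e\to e'$, $t\to t'$. Duplicator moves at $\exists$-positions, Spoiler at $\forall$-positions. Winning positions: polarity $\forall$ with no ALEA move available. Duplicator wins a maximal finite play iff its last position is winning, and an infinite play iff it visits winning positions infinitely often. *)

theory Defs
  imports Main
begin

datatype (letters: 'a) expr =
    Letter 'a
  | Zero
  | Top
  | One
  | Join "'a expr" "'a expr"  (infixl "\<squnion>" 65)
  | Meet "'a expr" "'a expr"  (infixl "\<sqinter>" 70)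
  | Comp "'a expr" "'a expr"  (infixl "\<star>" 75)
  | Dia "'a expr"  ("_\<^sup>\<diamond>" [1000] 999)

text \<open>The alphabet is an explicit set rather than a type of class \<open>finite\<close>, so that
  the empty alphabet is covered.\<close>

definition RegE :: "'a set \<Rightarrow> 'a expr set" where
  "RegE \<Sigma> = {e. letters e \<subseteq> \<Sigma>}"

text \<open>All axiom schemes range over \<open>RegE \<Sigma>\<close>. Where the side condition is omitted
  it follows from the premises, see \<open>srkam_RegE\<close>. An axiom \<open>a = b\<close> becomes two rules.\<close>

inductive srkam :: "'a set \<Rightarrow> 'a expr \<Rightarrow> 'a expr \<Rightarrow> bool" for \<Sigma> :: "'a set" where
  refl: "a \<in> RegE \<Sigma> \<Longrightarrow> srkam \<Sigma> a a"
| trans: "srkam \<Sigma> a b \<Longrightarrow> srkam \<Sigma> b c \<Longrightarrow> srkam \<Sigma> a c"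
| zero_le: "a \<in> RegE \<Sigma> \<Longrightarrow> srkam \<Sigma> Zero a"
| le_top: "a \<in> RegE \<Sigma> \<Longrightarrow> srkam \<Sigma> a Top"
| join_upper1: "a \<in> RegE \<Sigma> \<Longrightarrow> b \<in> RegE \<Sigma> \<Longrightarrow> srkam \<Sigma> a (a \<squnion> b)"
| join_upper2: "a \<in> RegE \<Sigma> \<Longrightarrow> b \<in> RegE \<Sigma> \<Longrightarrow> srkam \<Sigma> b (a \<squnion> b)"
| join_least: "srkam \<Sigma> b a \<Longrightarrow> srkam \<Sigma> c a \<Longrightarrow> srkam \<Sigma> (b \<squnion> c) a"
| meet_lower1: "a \<in> RegE \<Sigma> \<Longrightarrow> b \<in> RegE \<Sigma> \<Longrightarrow> srkam \<Sigma> (a \<sqinter> b) a"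
| meet_lower2: "a \<in> RegE \<Sigma> \<Longrightarrow> b \<in> RegE \<Sigma> \<Longrightarrow> srkam \<Sigma> (a \<sqinter> b) b"
| meet_greatest: "srkam \<Sigma> a b \<Longrightarrow> srkam \<Sigma> a c \<Longrightarrow> srkam \<Sigma> a (b \<sqinter> c)"
| meet_join_distrib: "a \<in> RegE \<Sigma> \<Longrightarrow> b \<in> RegE \<Sigma> \<Longrightarrow> c \<in> RegE \<Sigma> \<Longrightarrow>
    srkam \<Sigma> (a \<sqinter> (b \<squnion> c)) ((a \<sqinter> b) \<squnion> (a \<sqinter> c))"
| comp_one_le: "a \<in> RegE \<Sigma> \<Longrightarrow> srkam \<Sigma> (a \<star> One) a"
| le_comp_one: "a \<in> RegE \<Sigma> \<Longrightarrow> srkam \<Sigma> a (a \<star> One)"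
| one_comp_le: "a \<in> RegE \<Sigma> \<Longrightarrow> srkam \<Sigma> (One \<star> a) a"
| le_one_comp: "a \<in> RegE \<Sigma> \<Longrightarrow> srkam \<Sigma> a (One \<star> a)"
| comp_assoc1: "a \<in> RegE \<Sigma> \<Longrightarrow> b \<in> RegE \<Sigma> \<Longrightarrow> c \<in> RegE \<Sigma> \<Longrightarrow>
    srkam \<Sigma> (a \<star> (b \<star> c)) ((a \<star> b) \<star> c)"
| comp_assoc2: "a \<in> RegE \<Sigma> \<Longrightarrow> b \<in> RegE \<Sigma> \<Longrightarrow> c \<in> RegE \<Sigma> \<Longrightarrow>
    srkam \<Sigma> ((a \<star> b) \<star> c) (a \<star> (b \<star> c))"
| comp_mono: "srkam \<Sigma> a a' \<Longrightarrow> srkam \<Sigma> b b' \<Longrightarrow> srkam \<Sigma> (a \<star> b) (a' \<star> b')"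
| comp_zero: "a \<in> RegE \<Sigma> \<Longrightarrow> srkam \<Sigma> (a \<star> Zero) Zero"
| comp_top: "a \<in> RegE \<Sigma> \<Longrightarrow> srkam \<Sigma> Top (a \<star> Top)"
| comp_join: "a \<in> RegE \<Sigma> \<Longrightarrow> b \<in> RegE \<Sigma> \<Longrightarrow> c \<in> RegE \<Sigma> \<Longrightarrow>
    srkam \<Sigma> (a \<star> (b \<squnion> c)) ((a \<star> b) \<squnion> (a \<star> c))"
| comp_meet: "a \<in> RegE \<Sigma> \<Longrightarrow> b \<in> RegE \<Sigma> \<Longrightarrow> c \<in> RegE \<Sigma> \<Longrightarrow>
    srkam \<Sigma> ((a \<star> b) \<sqinter> (a \<star> c)) (a \<star> (b \<sqinter> c))"
| comp_meet_left: "a \<in> RegE \<Sigma> \<Longrightarrow> b \<in> RegE \<Sigma> \<Longrightarrow> c \<in> RegE \<Sigma> \<Longrightarrow>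
    srkam \<Sigma> ((a \<star> b) \<sqinter> c) ((a \<sqinter> c) \<star> b)"
| dia_one: "a \<in> RegE \<Sigma> \<Longrightarrow> srkam \<Sigma> One (a\<^sup>\<diamond>)"
| dia_unfold: "a \<in> RegE \<Sigma> \<Longrightarrow> srkam \<Sigma> (a\<^sup>\<diamond> \<star> a) (a\<^sup>\<diamond>)"
| dia_induct: "srkam \<Sigma> (a \<sqinter> (b \<star> c)) b \<Longrightarrow> srkam \<Sigma> (a \<sqinter> (b \<star> c\<^sup>\<diamond>)) b"

lemma srkam_RegE: "srkam \<Sigma> a b \<Longrightarrow> a \<in> RegE \<Sigma> \<and> b \<in> RegE \<Sigma>"
  by (induction rule: srkam.induct) (auto simp: RegE_def)

inductive trans_step :: "'a expr \<Rightarrow> 'a expr \<Rightarrow> bool"  (infix "\<leadsto>" 50) where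
  join1: "e \<squnion> f \<leadsto> e"
| join2: "e \<squnion> f \<leadsto> f"
| meet1: "e \<sqinter> f \<leadsto> e"
| meet2: "e \<sqinter> f \<leadsto> f"
| letter: "Letter a \<leadsto> One"
| comp_one: "e \<star> One \<leadsto> e"
| dia_stop: "e\<^sup>\<diamond> \<leadsto> One"
| dia_more: "e\<^sup>\<diamond> \<leadsto> e\<^sup>\<diamond> \<star> e"
| comp: "e \<leadsto> f \<Longrightarrow> g \<star> e \<leadsto> g \<star> f"

datatype 'a polarity = PExists | PForall | PQuery 'a

fun pol :: "'a expr \<Rightarrow> 'a polarity" where
  "pol (e \<star> f) = pol f"
| "pol (e \<squnion> f) = PExists"
| "pol One = PExists"
| "pol Zero = PExists"
| "pol (e\<^sup>\<diamond>) = PExists"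
| "pol (e \<sqinter> f) = PForall"
| "pol Top = PForall"
| "pol (Letter a) = PQuery a"

text \<open>\<open>Pos \<Gamma> X e\<close> is the position \<open>(\<Gamma> | X \<turnstile> e)\<close>.\<close>

datatype 'a position = Pos "'a set" "'a expr set" "'a expr"

definition positions :: "'a set \<Rightarrow> 'a position set" where
  "positions \<Sigma> = {Pos \<Gamma> X e | \<Gamma> X e. \<Gamma> \<subseteq> \<Sigma> \<and> finite X \<and> X \<subseteq> RegE \<Sigma> \<and> e \<in> RegE \<Sigma>}"

fun position_pol :: "'a position \<Rightarrow> 'a polarity" where
  "position_pol (Pos \<Gamma> X e) =
    (if \<exists>t \<in> X - {One}. pol t \<in> {PExists, PForall} then PForall
     else if pol e \<in> {PExists, PForall} then pol e
     else PExists)"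

datatype move_kind = Explore | Fork | Alea | Choose | Junk | Fill

inductive move :: "move_kind \<Rightarrow> 'a position \<Rightarrow> 'a position \<Rightarrow> bool" where
  explore: "t \<notin> X \<Longrightarrow> pol t = PExists \<Longrightarrow> t \<leadsto> t' \<Longrightarrow>
    move Explore (Pos \<Gamma> (X \<union> {t}) e) (Pos \<Gamma> (X \<union> {t'}) e)"
| fork: "t \<notin> X \<Longrightarrow> pol t = PForall \<Longrightarrow>
    move Fork (Pos \<Gamma> (X \<union> {t}) e) (Pos \<Gamma> (X \<union> {t'. t \<leadsto> t'}) e)"
| alea: "pol e = PForall \<Longrightarrow> \<forall>t \<in> X. pol t \<in> {PExists, PForall} \<longrightarrow> t = One \<Longrightarrow> e \<leadsto> e' \<Longrightarrow>
    move Alea (Pos \<Gamma> X e) (Pos \<Gamma> X e')"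
| choose: "position_pol (Pos \<Gamma> X e) = PExists \<Longrightarrow> pol e = PExists \<Longrightarrow> e \<leadsto> e' \<Longrightarrow>
    move Choose (Pos \<Gamma> X e) (Pos \<Gamma> X e')"
| junk: "position_pol (Pos \<Gamma> X e) = PExists \<Longrightarrow> pol e = PQuery a \<Longrightarrow> a \<in> \<Gamma> \<Longrightarrow> e \<leadsto> e' \<Longrightarrow>
    move Junk (Pos \<Gamma> X e) (Pos \<Gamma> X e')"
| fill: "t \<notin> X \<Longrightarrow> position_pol (Pos \<Gamma> (X \<union> {t}) e) = PExists \<Longrightarrow>
    pol e = PQuery a \<Longrightarrow> pol t = PQuery a \<Longrightarrow> e \<leadsto> e' \<Longrightarrow> t \<leadsto> t' \<Longrightarrow>
    move Fill (Pos \<Gamma> (X \<union> {t}) e) (Pos (\<Gamma> \<union> {a}) (X \<union> {t'}) e')"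

definition game_move :: "'a set \<Rightarrow> 'a position \<Rightarrow> 'a position \<Rightarrow> bool" where
  "game_move \<Sigma> p q \<longleftrightarrow> p \<in> positions \<Sigma> \<and> q \<in> positions \<Sigma> \<and> (\<exists>k. move k p q)"

lemma trans_step_letters: "e \<leadsto> f \<Longrightarrow> letters f \<subseteq> letters e"
  by (induction rule: trans_step.induct) auto

lemma finite_trans_step: "finite {f. e \<leadsto> f}"
proof (induction e)
  case (Comp g e)
  have "{f. g \<star> e \<leadsto> f} \<subseteq> insert g ((\<lambda>f. g \<star> f) ` {f. e \<leadsto> f})"
    by (auto elim: trans_step.cases)
  then show ?case using Comp.IH(2) by (meson finite.insertI finite_imageI finite_subset)
next
  case (Letter a)
  have "{f. Letter a \<leadsto> f} \<subseteq> {One}" by (auto elim: trans_step.cases)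
  then show ?case by (rule finite_subset) simp
next
  case (Join e1 e2)
  have "{f. e1 \<squnion> e2 \<leadsto> f} \<subseteq> {e1, e2}" by (auto elim: trans_step.cases)
  then show ?case by (rule finite_subset) simp
next
  case (Meet e1 e2)
  have "{f. e1 \<sqinter> e2 \<leadsto> f} \<subseteq> {e1, e2}" by (auto elim: trans_step.cases)
  then show ?case by (rule finite_subset) simp
next
  case (Dia e)
  have "{f. e\<^sup>\<diamond> \<leadsto> f} \<subseteq> {One, e\<^sup>\<diamond> \<star> e}" by (auto elim: trans_step.cases)
  then show ?case by (rule finite_subset) simp
qed (auto elim: trans_step.cases intro: finite_subset[of _ "{}"])

lemma pol_PQuery_letters: "pol e = PQuery a \<Longrightarrow> a \<in> letters e"
  by (induction e) auto

text \<open>Hence restricting both endpoints in \<open>game_move\<close> removes no move from a position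
  over \<open>\<Sigma>\<close>.\<close>

lemma move_positions:
  assumes "move k p q" "p \<in> positions \<Sigma>"
  shows "q \<in> positions \<Sigma>"
  using assms
  by (induction rule: move.induct)
    (auto simp: positions_def RegE_def finite_trans_step
      dest!: trans_step_letters pol_PQuery_letters)

definition winning_position :: "'a position \<Rightarrow> bool" where
  "winning_position p \<longleftrightarrow> position_pol p = PForall \<and> \<not> (\<exists>q. move Alea p q)"

definition finite_play :: "'a set \<Rightarrow> 'a position \<Rightarrow> 'a position list \<Rightarrow> bool" where
  "finite_play \<Sigma> p h \<longleftrightarrow> h \<noteq> [] \<and> hd h = p \<and> successively (game_move \<Sigma>) h"

definition maximal_finite_play :: "'a set \<Rightarrow> 'a position \<Rightarrow> 'a position list \<Rightarrow> bool" where
  "maximal_finite_play \<Sigma> p h \<longleftrightarrow> finite_play \<Sigma> p h \<and> \<not> (\<exists>q. game_move \<Sigma> (last h) q)"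

definition infinite_play :: "'a set \<Rightarrow> 'a position \<Rightarrow> (nat \<Rightarrow> 'a position) \<Rightarrow> bool" where
  "infinite_play \<Sigma> p \<pi> \<longleftrightarrow> \<pi> 0 = p \<and> (\<forall>n. game_move \<Sigma> (\<pi> n) (\<pi> (Suc n)))"

text \<open>A Duplicator strategy maps histories (nonempty finite plays) to positions. Only its
  values on histories ending in a position of polarity \<open>PExists\<close> with an available move
  matter, and there it has to pick a legal move.\<close>

definition duplicator_strategy ::
    "'a set \<Rightarrow> 'a position \<Rightarrow> ('a position list \<Rightarrow> 'a position) \<Rightarrow> bool" where
  "duplicator_strategy \<Sigma> p \<sigma> \<longleftrightarrow>
    (\<forall>h. finite_play \<Sigma> p h \<longrightarrow> position_pol (last h) = PExists \<longrightarrow>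
      (\<exists>q. game_move \<Sigma> (last h) q) \<longrightarrow> game_move \<Sigma> (last h) (\<sigma> h))"

definition finite_conforms :: "('a position list \<Rightarrow> 'a position) \<Rightarrow> 'a position list \<Rightarrow> bool" where
  "finite_conforms \<sigma> h \<longleftrightarrow>
    (\<forall>n. Suc n < length h \<longrightarrow> position_pol (h ! n) = PExists \<longrightarrow>
      h ! Suc n = \<sigma> (take (Suc n) h))"

definition infinite_conforms ::
    "('a position list \<Rightarrow> 'a position) \<Rightarrow> (nat \<Rightarrow> 'a position) \<Rightarrow> bool" where
  "infinite_conforms \<sigma> \<pi> \<longleftrightarrow>
    (\<forall>n. position_pol (\<pi> n) = PExists \<longrightarrow> \<pi> (Suc n) = \<sigma> (map \<pi> [0..<Suc n]))"

definition duplicator_winning_strategy ::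
    "'a set \<Rightarrow> 'a position \<Rightarrow> ('a position list \<Rightarrow> 'a position) \<Rightarrow> bool" where
  "duplicator_winning_strategy \<Sigma> p \<sigma> \<longleftrightarrow>
    duplicator_strategy \<Sigma> p \<sigma> \<and>
    (\<forall>h. maximal_finite_play \<Sigma> p h \<longrightarrow> finite_conforms \<sigma> h \<longrightarrow> winning_position (last h)) \<and>
    (\<forall>\<pi>. infinite_play \<Sigma> p \<pi> \<longrightarrow> infinite_conforms \<sigma> \<pi> \<longrightarrow>
      (\<exists>\<^sub>\<infinity>n. winning_position (\<pi> n)))"

end

theory Submission
  imports Defs
begin

text \<open>
  The moves of the game are followed with an expression \<open>V\<close> lying below all left-hand expressions
  (threads); the claim is that \<open>V\<close> lies below the right-hand side. The only delicate point is the
  iteration. Unfolding \<open>d\<^sup>\<diamond>\<close> in a thread \<open>t = g \<star> d\<^sup>\<diamond>\<close> of a left-hand state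
  \<open>s = (\<Gamma>, X)\<close>, one takes as induction invariant the meet of \<open>t\<close> with all right-hand sides \<open>f\<close> such
  that \<open>(\<Gamma> | X \<turnstile> f)\<close> is won. The pending copy of \<open>t\<close> is replaced by this invariant (a \<^emph>\<open>token\<close>),
  so that only \<open>d\<close> remains to be played and the weight of the thread decreases.
  When the token surfaces, \<open>V\<close> lies below every right-hand side won in state \<open>s\<close>. As meets are
  idempotent, \<open>V\<close> keeps this knowledge for ever, even if the other threads have moved in the meantime:
  reaching \<open>s\<close> again closes the proof, and there are only finitely many left-hand states.
  Finally, right-hand moves between two left-hand moves are well-founded by the Buechi condition.
\<close>

section \<open>Derivatives and stacks\<close>

inductive_cases trans_stepE:
  "Letter a \<leadsto> e'" "Zero \<leadsto> e'" "Top \<leadsto> e'" "One \<leadsto> e'" "e \<squnion> f \<leadsto> e'" "e \<sqinter> f \<leadsto> e'"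
  "g \<star> e \<leadsto> e'" "e\<^sup>\<diamond> \<leadsto> e'"

text \<open>Steps act on the last factor only, until it becomes \<open>One\<close> and is popped.
  Unfolding \<open>e\<^sup>\<diamond>\<close> therefore gives \<open>e\<^sup>\<diamond>\<close>
  composed with derivatives of \<open>e\<close>, and popping leads back to
  \<open>e\<^sup>\<diamond>\<close>.\<close>

lemma finite_derivatives: "finite {f. trans_step\<^sup>*\<^sup>* e f}"
proof (induction e)
  case (Comp g e)
  have "f \<in> (\<star>) g ` {f. trans_step\<^sup>*\<^sup>* e f} \<union> {f. trans_step\<^sup>*\<^sup>* g f}"
    if "trans_step\<^sup>*\<^sup>* (g \<star> e) f" for f
    using that
  proof (induction rule: rtranclp_induct)
    case (step y z)
    then show ?case
      by (auto elim!: trans_stepE intro: rtranclp.rtrancl_into_rtrancl)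
  qed auto
  then have "{f. trans_step\<^sup>*\<^sup>* (g \<star> e) f} \<subseteq> (\<star>) g ` {f. trans_step\<^sup>*\<^sup>* e f} \<union> {f. trans_step\<^sup>*\<^sup>* g f}"
    by auto
  then show ?case using Comp.IH by (meson finite_UnI finite_imageI finite_subset)
next
  case (Dia e)
  have "f \<in> {e\<^sup>\<diamond>, One} \<union> (\<star>) (e\<^sup>\<diamond>) ` {f. trans_step\<^sup>*\<^sup>* e f}"
    if "trans_step\<^sup>*\<^sup>* (e\<^sup>\<diamond>) f" for f
    using that
  proof (induction rule: rtranclp_induct)
    case (step y z)
    then show ?case
      by (auto elim!: trans_stepE intro: rtranclp.rtrancl_into_rtrancl)
  qed auto
  then have "{f. trans_step\<^sup>*\<^sup>* (e\<^sup>\<diamond>) f} \<subseteq> {e\<^sup>\<diamond>, One} \<union> (\<star>) (e\<^sup>\<diamond>) ` {f. trans_step\<^sup>*\<^sup>* e f}"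
    by auto
  then show ?case
    using Dia.IH by (meson finite.emptyI finite.insertI finite_UnI finite_imageI finite_subset)
next
  case (Join e1 e2)
  have "{f. trans_step\<^sup>*\<^sup>* (e1 \<squnion> e2) f}
      \<subseteq> {e1 \<squnion> e2} \<union> {f. trans_step\<^sup>*\<^sup>* e1 f} \<union> {f. trans_step\<^sup>*\<^sup>* e2 f}"
    by (auto elim: converse_rtranclpE elim!: trans_stepE)
  then show ?case
    using Join.IH by (meson finite.emptyI finite.insertI finite_UnI finite_subset)
next
  case (Meet e1 e2)
  have "{f. trans_step\<^sup>*\<^sup>* (e1 \<sqinter> e2) f}
      \<subseteq> {e1 \<sqinter> e2} \<union> {f. trans_step\<^sup>*\<^sup>* e1 f} \<union> {f. trans_step\<^sup>*\<^sup>* e2 f}"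
    by (auto elim: converse_rtranclpE elim!: trans_stepE)
  then show ?case
    using Meet.IH by (meson finite.emptyI finite.insertI finite_UnI finite_subset)
next
  case (Letter a)
  have "{f. trans_step\<^sup>*\<^sup>* (Letter a) f} \<subseteq> {Letter a, One}"
    by (auto elim!: trans_stepE elim: converse_rtranclpE)
  then show ?case by (rule finite_subset) simp
next
  case Zero
  have "{f. trans_step\<^sup>*\<^sup>* Zero f} \<subseteq> {Zero}" by (auto elim: converse_rtranclpE elim!: trans_stepE)
  then show ?case by (rule finite_subset) simp
next
  case Top
  have "{f. trans_step\<^sup>*\<^sup>* Top f} \<subseteq> {Top}" by (auto elim: converse_rtranclpE elim!: trans_stepE)
  then show ?case by (rule finite_subset) simp
next
  case One
  have "{f. trans_step\<^sup>*\<^sup>* One f} \<subseteq> {One}" by (auto elim: converse_rtranclpE elim!: trans_stepE)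
  then show ?case by (rule finite_subset) simp
qed

lemma derivatives_RegE: "trans_step\<^sup>*\<^sup>* e f \<Longrightarrow> e \<in> RegE \<Sigma> \<Longrightarrow> f \<in> RegE \<Sigma>"
  by (induction rule: rtranclp_induct) (auto simp: RegE_def dest!: trans_step_letters)

section \<open>Right-nested compositions with an active last factor\<close>

abbreviation stack :: "'a expr list \<Rightarrow> 'a expr \<Rightarrow> 'a expr" where
  "stack \<equiv> foldr (\<star>)"

lemma stack_step: "r \<leadsto> r' \<Longrightarrow> stack xs r \<leadsto> stack xs r'"
  by (induction xs) (auto intro: trans_step.comp)

lemma pol_stack [simp]: "pol (stack xs r) = pol r"
  by (induction xs) auto

lemma stack_decomp: obtains xs r where "c = stack xs r" "\<And>x y. r \<noteq> x \<star> y"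
proof (induction c arbitrary: thesis)
  case (Comp g e)
  obtain xs r where "e = stack xs r" "\<And>x y. r \<noteq> x \<star> y" using Comp.IH(2) by blast
  then show ?case using Comp.prems[of "g # xs" r] by simp
qed (metis expr.distinct foldr.simps(1) id_apply)+

text \<open>With \<open>One\<close> excluded as head, nothing can be popped, so the prefix is
  inert.\<close>

lemma stack_step_iff:
  assumes "\<And>x y. r \<noteq> x \<star> y" "r \<noteq> One"
  shows "stack xs r \<leadsto> t \<longleftrightarrow> (\<exists>r'. r \<leadsto> r' \<and> t = stack xs r')"
proof (induction xs arbitrary: t)
  case (Cons x xs)
  have "stack xs r \<noteq> One" using assms by (cases xs) auto
  then show ?case using Cons.IH by (auto elim!: trans_stepE intro: trans_step.comp)
qed simp

lemma letter_step:
  assumes "pol f = PQuery a" "f \<leadsto> f'"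
  obtains xs where "f = stack xs (Letter a)" "f' = stack xs One"
proof -
  obtain xs r where f: "f = stack xs r" and r: "\<And>x y. r \<noteq> x \<star> y" by (rule stack_decomp) blast
  have "r = Letter a" using assms(1) f r by (cases r) auto
  then show ?thesis
    using assms(2) stack_step_iff[of r xs] r that f by (auto elim!: trans_stepE)
qed

lemma stack_RegE [simp]: "stack xs r \<in> RegE \<Sigma> \<longleftrightarrow> set xs \<subseteq> RegE \<Sigma> \<and> r \<in> RegE \<Sigma>"
  by (induction xs) (auto simp: RegE_def)

lemma RegE_simps [simp]:
  "Zero \<in> RegE \<Sigma>" "Top \<in> RegE \<Sigma>" "One \<in> RegE \<Sigma>"
  "Letter x \<in> RegE \<Sigma> \<longleftrightarrow> x \<in> \<Sigma>"
  "a \<squnion> b \<in> RegE \<Sigma> \<longleftrightarrow> a \<in> RegE \<Sigma> \<and> b \<in> RegE \<Sigma>"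
  "a \<sqinter> b \<in> RegE \<Sigma> \<longleftrightarrow> a \<in> RegE \<Sigma> \<and> b \<in> RegE \<Sigma>"
  "a \<star> b \<in> RegE \<Sigma> \<longleftrightarrow> a \<in> RegE \<Sigma> \<and> b \<in> RegE \<Sigma>"
  "a\<^sup>\<diamond> \<in> RegE \<Sigma> \<longleftrightarrow> a \<in> RegE \<Sigma>"
  by (auto simp: RegE_def)

text \<open>Multiplicative on compositions, so that both branches of a fork together weigh less than
  the forked thread.\<close>

fun weight :: "'a expr \<Rightarrow> nat" where
  "weight (Letter a) = 3"
| "weight Zero = 2"
| "weight Top = 2"
| "weight One = 2"
| "weight (e \<squnion> f) = weight e + weight f + 1"
| "weight (e \<sqinter> f) = weight e + weight f + 1"
| "weight (e \<star> f) = weight e * weight f"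
| "weight (e\<^sup>\<diamond>) = weight e + 2"

lemma weight_pos [simp]: "0 < weight e"
  by (induction e) auto

lemma weight_stack: "weight (stack xs r) = prod_list (map weight xs) * weight r"
  by (induction xs) auto

lemma prod_list_weight_pos [simp]: "0 < prod_list (map weight xs)"
  by (induction xs) auto

section \<open>Derived inequalities\<close>

locale alphabet =
  fixes \<Sigma> :: "'a set"
begin

abbreviation leq :: "'a expr \<Rightarrow> 'a expr \<Rightarrow> bool"  (infix "\<sqsubseteq>" 50) where
  "a \<sqsubseteq> b \<equiv> srkam \<Sigma> a b"

lemma leq_RegE: "a \<sqsubseteq> b \<Longrightarrow> a \<in> RegE \<Sigma>" "a \<sqsubseteq> b \<Longrightarrow> b \<in> RegE \<Sigma>"
  using srkam_RegE by auto

lemmas leq_trans [trans] = srkam.trans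

lemma comp_mono_left: "a \<sqsubseteq> b \<Longrightarrow> c \<in> RegE \<Sigma> \<Longrightarrow> a \<star> c \<sqsubseteq> b \<star> c"
  by (intro srkam.comp_mono srkam.refl)

lemma comp_mono_right: "a \<sqsubseteq> b \<Longrightarrow> c \<in> RegE \<Sigma> \<Longrightarrow> c \<star> a \<sqsubseteq> c \<star> b"
  by (intro srkam.comp_mono srkam.refl)

section \<open>Axioms lifted through stacks\<close>

lemma stack_mono: "set xs \<subseteq> RegE \<Sigma> \<Longrightarrow> r \<sqsubseteq> r' \<Longrightarrow> stack xs r \<sqsubseteq> stack xs r'"
  by (induction xs) (auto intro!: comp_mono_left comp_mono_right)

lemma stack_assoc1:
  "set xs \<subseteq> RegE \<Sigma> \<Longrightarrow> r \<in> RegE \<Sigma> \<Longrightarrow> stack xs r \<sqsubseteq> stack xs One \<star> r"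
proof (induction xs)
  case (Cons x xs)
  then have "stack xs r \<sqsubseteq> stack xs One \<star> r" by simp
  then have "x \<star> stack xs r \<sqsubseteq> x \<star> (stack xs One \<star> r)"
    using Cons.prems by (auto intro!: comp_mono_left comp_mono_right)
  also have "\<dots> \<sqsubseteq> x \<star> stack xs One \<star> r" using Cons.prems by (auto intro: srkam.comp_assoc1)
  finally show ?case by simp
qed (auto intro: srkam.le_one_comp)

lemma stack_assoc2:
  "set xs \<subseteq> RegE \<Sigma> \<Longrightarrow> r \<in> RegE \<Sigma> \<Longrightarrow> stack xs One \<star> r \<sqsubseteq> stack xs r"
proof (induction xs)
  case (Cons x xs)
  have "x \<star> stack xs One \<star> r \<sqsubseteq> x \<star> (stack xs One \<star> r)"
    using Cons.prems by (auto intro: srkam.comp_assoc2)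
  also have "\<dots> \<sqsubseteq> x \<star> stack xs r" using Cons by (auto intro!: comp_mono_left comp_mono_right)
  finally show ?case by simp
qed (auto intro: srkam.one_comp_le)

lemma stack_zero: "set xs \<subseteq> RegE \<Sigma> \<Longrightarrow> stack xs Zero \<sqsubseteq> Zero"
proof (induction xs)
  case (Cons x xs)
  then have "x \<star> stack xs Zero \<sqsubseteq> x \<star> Zero" by (auto intro!: comp_mono_left comp_mono_right)
  also have "\<dots> \<sqsubseteq> Zero" using Cons.prems by (auto intro: srkam.comp_zero)
  finally show ?case by simp
qed (auto intro: srkam.refl)

lemma stack_top: "set xs \<subseteq> RegE \<Sigma> \<Longrightarrow> Top \<sqsubseteq> stack xs Top"
proof (induction xs)
  case (Cons x xs)
  have "Top \<sqsubseteq> x \<star> Top" using Cons.prems by (auto intro: srkam.comp_top)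
  also have "\<dots> \<sqsubseteq> x \<star> stack xs Top" using Cons by (auto intro!: comp_mono_left comp_mono_right)
  finally show ?case by simp
qed (auto intro: srkam.refl)

lemma stack_join:
  assumes "set xs \<subseteq> RegE \<Sigma>" "u \<in> RegE \<Sigma>" "v \<in> RegE \<Sigma>"
  shows "stack xs (u \<squnion> v) \<sqsubseteq> stack xs u \<squnion> stack xs v"
  using assms(1)
proof (induction xs)
  case (Cons x xs)
  then have "x \<star> stack xs (u \<squnion> v) \<sqsubseteq> x \<star> (stack xs u \<squnion> stack xs v)"
    by (auto intro!: comp_mono_left comp_mono_right)
  also have "\<dots> \<sqsubseteq> x \<star> stack xs u \<squnion> x \<star> stack xs v"
    using Cons.prems assms by (auto intro: srkam.comp_join)
  finally show ?case by simp
qed (use assms in \<open>auto intro: srkam.refl\<close>)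

lemma stack_meet:
  assumes "set xs \<subseteq> RegE \<Sigma>" "u \<in> RegE \<Sigma>" "v \<in> RegE \<Sigma>"
  shows "stack xs u \<sqinter> stack xs v \<sqsubseteq> stack xs (u \<sqinter> v)"
  using assms(1)
proof (induction xs)
  case (Cons x xs)
  have "x \<star> stack xs u \<sqinter> x \<star> stack xs v \<sqsubseteq> x \<star> (stack xs u \<sqinter> stack xs v)"
    using Cons.prems assms by (auto intro: srkam.comp_meet)
  also have "\<dots> \<sqsubseteq> x \<star> stack xs (u \<sqinter> v)"
    using Cons by (auto intro!: comp_mono_left comp_mono_right)
  finally show ?case by simp
qed (use assms in \<open>auto intro: srkam.refl\<close>)

text \<open>Splitting off a last factor loses no context: by \<open>comp_meet_left\<close> the bound
  \<open>V\<close> passes to the remaining prefix, so all that lies above \<open>V\<close> also lies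
  above the new bound.\<close>

lemma leq_meet_comp:
  assumes "V \<sqsubseteq> y \<star> c"
  shows "V \<sqsubseteq> (V \<sqinter> y) \<star> c"
proof -
  have R: "V \<in> RegE \<Sigma>" "y \<in> RegE \<Sigma>" "c \<in> RegE \<Sigma>" using leq_RegE[OF assms] by auto
  have "V \<sqsubseteq> (y \<star> c) \<sqinter> V" using assms R by (auto intro: srkam.meet_greatest srkam.refl)
  also have "\<dots> \<sqsubseteq> (y \<sqinter> V) \<star> c" using R by (auto intro: srkam.comp_meet_left)
  also have "\<dots> \<sqsubseteq> (V \<sqinter> y) \<star> c"
    using R by (intro comp_mono_left srkam.meet_greatest srkam.meet_lower1 srkam.meet_lower2)
  finally show ?thesis .
qed

lemma leq_join_cases:
  assumes "V \<sqsubseteq> p \<squnion> q" "V \<sqinter> p \<sqsubseteq> f" "V \<sqinter> q \<sqsubseteq> f"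
  shows "V \<sqsubseteq> f"
proof -
  have R: "V \<in> RegE \<Sigma>" "p \<in> RegE \<Sigma>" "q \<in> RegE \<Sigma>" using leq_RegE[OF assms(1)] by auto
  have "V \<sqsubseteq> V \<sqinter> (p \<squnion> q)" using assms R by (auto intro: srkam.meet_greatest srkam.refl)
  also have "\<dots> \<sqsubseteq> (V \<sqinter> p) \<squnion> (V \<sqinter> q)" using R by (auto intro: srkam.meet_join_distrib)
  also have "\<dots> \<sqsubseteq> f" using assms by (auto intro: srkam.join_least)
  finally show ?thesis .
qed

text \<open>The induction axiom relative to the context \<open>V\<close>, with invariant
  \<open>b\<close>. The prefix \<open>y\<close> in front of the iteration is first strengthened by
  \<open>V\<close>, so the base case may use \<open>V\<close> as well.\<close>

lemma leq_dia_cases: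
  assumes "V \<sqsubseteq> y \<star> d\<^sup>\<diamond>" "V \<sqinter> y \<sqsubseteq> b" "V \<sqinter> (b \<star> d) \<sqsubseteq> b"
  shows "V \<sqsubseteq> b"
proof -
  have R: "V \<in> RegE \<Sigma>" "y \<in> RegE \<Sigma>" "d \<in> RegE \<Sigma>" using leq_RegE[OF assms(1)] by auto
  have "V \<sqsubseteq> (V \<sqinter> y) \<star> d\<^sup>\<diamond>" by (rule leq_meet_comp[OF assms(1)])
  also have "\<dots> \<sqsubseteq> b \<star> d\<^sup>\<diamond>" using assms(2) R by (auto intro!: comp_mono_left comp_mono_right)
  finally have "V \<sqsubseteq> V \<sqinter> (b \<star> d\<^sup>\<diamond>)" using R by (auto intro: srkam.meet_greatest srkam.refl)
  also have "\<dots> \<sqsubseteq> b" using assms(3) by (rule srkam.dia_induct)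
  finally show ?thesis .
qed

lemma exists_step_leq:
  "e \<leadsto> e' \<Longrightarrow> pol e = PExists \<Longrightarrow> e \<in> RegE \<Sigma> \<Longrightarrow> e' \<sqsubseteq> e"
  by (induction rule: trans_step.induct) (auto intro: srkam.intros)

lemma finite_meet_exists:
  assumes "finite F" "F \<subseteq> RegE \<Sigma>"
  obtains m where "m \<in> RegE \<Sigma>" "\<And>f. f \<in> F \<Longrightarrow> m \<sqsubseteq> f"
    "\<And>v. v \<in> RegE \<Sigma> \<Longrightarrow> (\<And>f. f \<in> F \<Longrightarrow> v \<sqsubseteq> f) \<Longrightarrow> v \<sqsubseteq> m"
  using assms
proof (induction F arbitrary: thesis rule: finite_induct)
  case empty
  show ?case by (rule empty(1)[of Top]) (auto intro: srkam.le_top)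
next
  case (insert g F)
  obtain m where m: "m \<in> RegE \<Sigma>" "\<And>f. f \<in> F \<Longrightarrow> m \<sqsubseteq> f"
    "\<And>v. v \<in> RegE \<Sigma> \<Longrightarrow> (\<And>f. f \<in> F \<Longrightarrow> v \<sqsubseteq> f) \<Longrightarrow> v \<sqsubseteq> m"
    using insert.IH insert.prems(2) by (metis insert_subset)
  have g: "g \<in> RegE \<Sigma>" using insert.prems by auto
  show ?case
  proof (rule insert.prems(1)[of "g \<sqinter> m"])
    show "g \<sqinter> m \<in> RegE \<Sigma>" using g m(1) by simp
    show "g \<sqinter> m \<sqsubseteq> f" if "f \<in> insert g F" for f
      using that g m(1) by (auto intro: srkam.meet_lower1 srkam.trans[OF srkam.meet_lower2 m(2)])
    show "v \<sqsubseteq> g \<sqinter> m" if "v \<in> RegE \<Sigma>" "\<And>f. f \<in> insert g F \<Longrightarrow> v \<sqsubseteq> f" for v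
      using that m(3)[of v] by (auto intro: srkam.meet_greatest)
  qed
qed

end

section \<open>Winning regions\<close>

text \<open>The negation of the first clause of \<open>position_pol\<close>, and also the guard of
  Alea: no thread other than \<open>One\<close> forces a left-hand move.\<close>

definition settled :: "'a expr set \<Rightarrow> bool" where
  "settled X \<longleftrightarrow> (\<forall>t \<in> X. pol t \<in> {PExists, PForall} \<longrightarrow> t = One)"

text \<open>Duplicator can force the play into \<open>Y\<close> by a left-hand move (or stop at \<open>\<top>\<close>), after
  finitely many moves on the right.\<close>

inductive attracted :: "'a position set \<Rightarrow> 'a set \<Rightarrow> 'a expr set \<Rightarrow> 'a expr \<Rightarrow> bool"
  for Y \<Gamma> X where
  left: "\<not> settled X \<Longrightarrow>
    (\<And>k q. k \<in> {Explore, Fork} \<Longrightarrow> move k (Pos \<Gamma> X f) q \<Longrightarrow> q \<in> Y) \<Longrightarrow> attracted Y \<Gamma> X f"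
| alea: "settled X \<Longrightarrow> pol f = PForall \<Longrightarrow> (\<And>f'. f \<leadsto> f' \<Longrightarrow> attracted Y \<Gamma> X f') \<Longrightarrow>
    attracted Y \<Gamma> X f"
| choose: "settled X \<Longrightarrow> pol f = PExists \<Longrightarrow> f \<leadsto> f' \<Longrightarrow> attracted Y \<Gamma> X f' \<Longrightarrow>
    attracted Y \<Gamma> X f"
| junk: "settled X \<Longrightarrow> pol f = PQuery a \<Longrightarrow> a \<in> \<Gamma> \<Longrightarrow> f \<leadsto> f' \<Longrightarrow> attracted Y \<Gamma> X f' \<Longrightarrow>
    attracted Y \<Gamma> X f"
| fill: "settled X \<Longrightarrow> pol f = PQuery a \<Longrightarrow> t \<in> X \<Longrightarrow> pol t = PQuery a \<Longrightarrow> f \<leadsto> f' \<Longrightarrow> t \<leadsto> t' \<Longrightarrow>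
    Pos (\<Gamma> \<union> {a}) (X - {t} \<union> {t'}) f' \<in> Y \<Longrightarrow> attracted Y \<Gamma> X f"

lemma attracted_unsettled:
  assumes "attracted Y \<Gamma> X f" "\<not> settled X" "k \<in> {Explore, Fork}" "move k (Pos \<Gamma> X f) q"
  shows "q \<in> Y"
  using assms(1)
proof cases
  case left
  show ?thesis by (rule left(2)[OF assms(3,4)])
qed (use assms(2) in simp_all)

text \<open>Abstracts from strategies: \<open>Y\<close> is a post-fixed point of the attractor.
  Finiteness of \<open>E\<close> gives meets of all right-hand sides won in a state; finiteness of
  \<open>\<Sigma>\<close> and \<open>D\<close> bounds the number of states.\<close>

locale winning_region = alphabet \<Sigma> for \<Sigma> :: "'a set" +
  fixes Y :: "'a position set" and D E :: "'a expr set"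
  assumes finite_\<Sigma>: "finite \<Sigma>" and finite_D: "finite D" and finite_E: "finite E"
    and D_RegE: "D \<subseteq> RegE \<Sigma>" and E_RegE: "E \<subseteq> RegE \<Sigma>"
    and Y_bounded: "Pos \<Gamma> X f \<in> Y \<Longrightarrow> \<Gamma> \<subseteq> \<Sigma> \<and> X \<subseteq> D \<and> f \<in> E"
    and Y_attracted: "Pos \<Gamma> X f \<in> Y \<Longrightarrow> attracted Y \<Gamma> X f"
begin

lemma Y_RegE: "Pos \<Gamma> X f \<in> Y \<Longrightarrow> f \<in> RegE \<Sigma>" "Pos \<Gamma> X f \<in> Y \<Longrightarrow> t \<in> X \<Longrightarrow> t \<in> RegE \<Sigma>"
  using Y_bounded[of \<Gamma> X f] D_RegE E_RegE by auto

lemma Y_finite: "Pos \<Gamma> X f \<in> Y \<Longrightarrow> finite X"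
  using Y_bounded[of \<Gamma> X f] finite_D by (auto intro: finite_subset)

lemma explore_closed:
  assumes Y: "Pos \<Gamma> X f \<in> Y" and t: "t \<in> X" "t \<noteq> One" "pol t = PExists" "t \<leadsto> t'"
  shows "Pos \<Gamma> (X - {t} \<union> {t'}) f \<in> Y"
proof (rule attracted_unsettled[OF Y_attracted[OF Y], of Explore])
  show "\<not> settled X" using t(1-3) by (auto simp: settled_def)
  have "X - {t} \<union> {t} = X" using t(1) by blast
  with move.explore[of t "X - {t}" t' \<Gamma> f, OF _ t(3,4)]
  show "move Explore (Pos \<Gamma> X f) (Pos \<Gamma> (X - {t} \<union> {t'}) f)" by (metis Diff_iff singletonI)
qed simp

lemma fork_closed:
  assumes Y: "Pos \<Gamma> X f \<in> Y" and t: "t \<in> X" "pol t = PForall"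
  shows "Pos \<Gamma> (X - {t} \<union> {t'. t \<leadsto> t'}) f \<in> Y"
proof (rule attracted_unsettled[OF Y_attracted[OF Y], of Fork])
  have "t \<noteq> One" using t(2) by auto
  with t show "\<not> settled X" unfolding settled_def by blast
  have X: "X - {t} \<union> {t} = X" using t(1) by blast
  have "move Fork (Pos \<Gamma> (X - {t} \<union> {t}) f) (Pos \<Gamma> (X - {t} \<union> {t'. t \<leadsto> t'}) f)"
    by (rule move.fork) (use t(2) in simp_all)
  then show "move Fork (Pos \<Gamma> X f) (Pos \<Gamma> (X - {t} \<union> {t'. t \<leadsto> t'}) f)"
    by (simp only: X)
qed simp

section \<open>Knowledge, tokens and weighted bounds\<close>

definition states :: "('a set \<times> 'a expr set) set" where
  "states = Pow \<Sigma> \<times> Pow D"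

lemma finite_states: "finite states"
  using finite_\<Sigma> finite_D by (simp add: states_def)

definition knows :: "'a expr \<Rightarrow> 'a set \<times> 'a expr set \<Rightarrow> bool" where
  "knows b s \<longleftrightarrow> (\<forall>f. Pos (fst s) (snd s) f \<in> Y \<longrightarrow> b \<sqsubseteq> f)"

text \<open>A thread \<open>t = stack ks c\<close> is represented by \<open>b \<star> c\<close>, where the token \<open>b\<close> stands for
  the part \<open>ks\<close> that is not going to be played. For an original thread, \<open>ks = []\<close>.\<close>

definition tracks :: "('a set \<times> 'a expr set) set \<Rightarrow> 'a expr \<Rightarrow> 'a expr \<Rightarrow> nat \<Rightarrow> bool" where
  "tracks A V t n \<longleftrightarrow> (\<exists>ks b c. t = stack ks c \<and> V \<sqsubseteq> b \<star> c \<and> b \<sqsubseteq> stack ks One \<and> n = weight c \<and>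
    (ks = [] \<or> (\<exists>s \<in> states - A. knows b s)))"

text \<open>The invariant carried by \<open>V\<close>, apart from weights inherited by every smaller
  bound. \<open>V \<sqsubseteq> Top \<star> Letter a\<close> is what is kept of a letter consumed by
  Fill, and is enough to justify Junk; \<open>A\<close> collects the states already known.\<close>

definition supports ::
    "('a set \<times> 'a expr set) set \<Rightarrow> 'a expr \<Rightarrow> 'a set \<Rightarrow> 'a expr set \<Rightarrow> ('a expr \<Rightarrow> nat) \<Rightarrow> bool" where
  "supports A V \<Gamma> X \<omega> \<longleftrightarrow> V \<in> RegE \<Sigma> \<and> (\<forall>t \<in> X. tracks A V t (\<omega> t)) \<and>
    (\<forall>a \<in> \<Gamma>. V \<sqsubseteq> Top \<star> Letter a) \<and> (\<forall>s \<in> A. knows V s)"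

lemma knows_mono: "V' \<sqsubseteq> V \<Longrightarrow> knows V s \<Longrightarrow> knows V' s"
  by (auto simp: knows_def intro: srkam.trans)

lemma tracks_mono: "V' \<sqsubseteq> V \<Longrightarrow> tracks A V t n \<Longrightarrow> tracks A V' t n"
  unfolding tracks_def by (elim ex_forward conj_forward) (assumption | rule srkam.trans)+

lemma tracks_refl:
  assumes "V \<sqsubseteq> t"
  shows "tracks A V t (weight t)"
proof -
  have "V \<sqsubseteq> One \<star> t"
    using assms leq_RegE[OF assms] by (meson srkam.le_one_comp srkam.trans)
  then show ?thesis
    unfolding tracks_def
    by (intro exI[of _ "[]"] exI[of _ One] exI[of _ t]) (auto intro: srkam.refl)
qed

text \<open>Putting the actual prefix \<open>ks\<close> back in place of the token \<open>b\<close>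
  only enlarges \<open>b \<star> c\<close>.\<close>

lemma tracks_leq:
  assumes "tracks A V t n" "t \<in> RegE \<Sigma>"
  shows "V \<sqsubseteq> t"
proof -
  obtain ks b c where t: "t = stack ks c" and V: "V \<sqsubseteq> b \<star> c" and b: "b \<sqsubseteq> stack ks One"
    using assms(1) unfolding tracks_def by blast
  have R: "set ks \<subseteq> RegE \<Sigma>" "c \<in> RegE \<Sigma>" using assms(2) t by auto
  note V
  also have "b \<star> c \<sqsubseteq> stack ks One \<star> c" using b R by (auto intro!: comp_mono_left comp_mono_right)
  also have "\<dots> \<sqsubseteq> t" unfolding t using R by (rule stack_assoc2)
  finally show ?thesis .
qed

text \<open>A new thread may coincide with an old one. It then keeps the old weight and is counted
  once, so merging cannot raise the total.\<close>

lemma supports_step: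
  assumes S: "supports A V \<Gamma> X \<omega>" and t: "t \<in> X" and V': "V' \<sqsubseteq> V"
    and fin: "finite X" "finite C"
    and C: "\<And>t'. t' \<in> C \<Longrightarrow> tracks A V' t' (n t')" and less: "sum n C < \<omega> t"
  obtains \<omega>' where "supports A V' \<Gamma> (X - {t} \<union> C) \<omega>'"
    "sum \<omega>' (X - {t} \<union> C) < sum \<omega> X"
proof -
  define \<omega>' where "\<omega>' y = (if y \<in> X - {t} then \<omega> y else n y)" for y
  have "supports A V' \<Gamma> (X - {t} \<union> C) \<omega>'"
    using S C V' leq_RegE(1)[OF V']
    by (auto simp: supports_def \<omega>'_def intro: tracks_mono knows_mono srkam.trans)
  moreover have "sum \<omega>' (X - {t} \<union> C) < sum \<omega> X"
  proof -
    have "sum \<omega>' (X - {t} \<union> C) = sum \<omega>' (X - {t}) + sum \<omega>' (C - (X - {t}))"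
      using sum.union_disjoint[of "X - {t}" "C - (X - {t})" \<omega>'] fin by auto
    also have "sum \<omega>' (X - {t}) = sum \<omega> (X - {t})" by (rule sum.cong) (auto simp: \<omega>'_def)
    also have "sum \<omega>' (C - (X - {t})) = sum n (C - (X - {t}))"
      by (rule sum.cong) (auto simp: \<omega>'_def)
    also have "\<dots> \<le> sum n C" using fin by (intro sum_mono2) auto
    also have "sum \<omega> (X - {t}) + sum n C < sum \<omega> X"
      using less sum.remove[OF fin(1) t, of \<omega>] by simp
    finally show ?thesis by simp
  qed
  ultimately show ?thesis by (rule that)
qed

text \<open>All left-hand moves stay in \<open>Y\<close>, so any thread \<open>t\<close> other than
  \<open>One\<close> that can be explored or forked may be chosen. The two induction hypotheses form
  a lexicographic order: more known states, or equal knowledge and smaller total weight.\<close>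

lemma unsettled_leq:
  assumes more_knowledge: "\<And>A' \<Gamma> X f V \<omega>. A \<subset> A' \<Longrightarrow> A' \<subseteq> states \<Longrightarrow> Pos \<Gamma> X f \<in> Y \<Longrightarrow>
      supports A' V \<Gamma> X \<omega> \<Longrightarrow> V \<sqsubseteq> f"
    and less_weight: "\<And>\<Gamma>' X' f' V' \<omega>'. sum \<omega>' X' < sum \<omega> X \<Longrightarrow> Pos \<Gamma>' X' f' \<in> Y \<Longrightarrow>
      supports A V' \<Gamma>' X' \<omega>' \<Longrightarrow> V' \<sqsubseteq> f'"
    and A: "A \<subseteq> states" and Y: "Pos \<Gamma> X f \<in> Y" and S: "supports A V \<Gamma> X \<omega>"
    and t: "t \<in> X" "t \<noteq> One" "pol t \<in> {PExists, PForall}"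
  shows "V \<sqsubseteq> f"
proof -
  have V: "V \<in> RegE \<Sigma>" using S by (simp add: supports_def)
  have fin: "finite X" using Y by (rule Y_finite)
  have tR: "t \<in> RegE \<Sigma>" using Y_RegE(2)[OF Y t(1)] .
  obtain ks b c where ks: "t = stack ks c" and Vc: "V \<sqsubseteq> b \<star> c" and b: "b \<sqsubseteq> stack ks One"
    and wc: "\<omega> t = weight c" and token: "ks = [] \<or> (\<exists>s \<in> states - A. knows b s)"
    using S t(1) unfolding supports_def tracks_def by blast
  obtain xs r where c: "c = stack xs r" and r: "\<And>x y. r \<noteq> x \<star> y" by (rule stack_decomp) blast
  have tr: "t = stack (ks @ xs) r" by (simp add: ks c)
  have R: "set ks \<subseteq> RegE \<Sigma>" "set xs \<subseteq> RegE \<Sigma>" "r \<in> RegE \<Sigma>" "b \<in> RegE \<Sigma>"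
    using tR tr leq_RegE[OF b] by auto
  have Vr: "V \<sqsubseteq> stack (b # xs) r" using Vc c by simp
  have bxs: "set (b # xs) \<subseteq> RegE \<Sigma>" using R by simp
  define P where "P = prod_list (map weight xs)"
  have P: "0 < P" by (simp add: P_def)
  have tracks_same: "tracks A V' (stack (ks @ xs) r') (P * weight r')"
    if "V' \<sqsubseteq> stack (b # xs) r'" for V' r'
    unfolding tracks_def using that b token
    by (intro exI[of _ ks] exI[of _ b] exI[of _ "stack xs r'"]) (auto simp: P_def weight_stack)
  have replace: "V' \<sqsubseteq> f'"
    if C: "Pos \<Gamma> (X - {t} \<union> C) f' \<in> Y" "V' \<sqsubseteq> V" "finite C"
      "\<And>t'. t' \<in> C \<Longrightarrow> tracks A V' t' (n t')" "sum n C < \<omega> t" for C f' V' n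
  proof -
    obtain \<omega>' where "supports A V' \<Gamma> (X - {t} \<union> C) \<omega>'" "sum \<omega>' (X - {t} \<union> C) < sum \<omega> X"
      using supports_step[OF S t(1) C(2) fin C(3-5)] by blast
    then show ?thesis using C(1) by (intro less_weight)
  qed
  have replace1: "V' \<sqsubseteq> f'"
    if "Pos \<Gamma> X f' \<in> Y" "t \<leadsto> t'" "pol t = PExists" "V' \<sqsubseteq> V" "tracks A V' t' n" "n < \<omega> t"
    for t' f' V' n
    using explore_closed[OF that(1) t(1,2) that(3,2)] that(4-6)
    by (intro replace[of "{t'}" f' V' "\<lambda>_. n"]) auto
  \<comment> \<open>The right-hand side is left arbitrary because the iteration needs this for all
    right-hand sides won in the current state.\<close>
  have advance: "V \<sqinter> stack (b # xs) r' \<sqsubseteq> f'"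
    if f': "Pos \<Gamma> X f' \<in> Y" and step: "r \<leadsto> r'" "pol r = PExists"
      and r': "r' \<in> RegE \<Sigma>" "weight r' < weight r" for r' f'
  proof (rule replace1[OF f'])
    show "t \<leadsto> stack (ks @ xs) r'" unfolding tr using step(1) by (rule stack_step)
    show "pol t = PExists" using step(2) by (simp add: tr)
    have y: "stack (b # xs) r' \<in> RegE \<Sigma>" using bxs r' by simp
    show "V \<sqinter> stack (b # xs) r' \<sqsubseteq> V" using V y by (rule srkam.meet_lower1)
    show "tracks A (V \<sqinter> stack (b # xs) r') (stack (ks @ xs) r') (P * weight r')"
      using srkam.meet_lower2[OF V y] by (rule tracks_same)
    show "P * weight r' < \<omega> t" using r'(2) P by (simp add: wc c weight_stack P_def)
  qed
  show ?thesis
  proof (cases r)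
    case (Letter a)
    then show ?thesis using t(3) tr by simp
  next
    case Zero
    have "V \<sqsubseteq> Zero" using Vr stack_zero[OF bxs] unfolding Zero by (rule srkam.trans)
    also have "Zero \<sqsubseteq> f" using Y_RegE(1)[OF Y] by (rule srkam.zero_le)
    finally show ?thesis .
  next
    case Top
    \<comment> \<open>Forking at \<open>Top\<close> has no successors: the thread simply
      vanishes.\<close>
    have "{t'. t \<leadsto> t'} = {}"
      unfolding tr using stack_step_iff[of r "ks @ xs"] r Top by (auto elim!: trans_stepE)
    then have "Pos \<Gamma> (X - {t} \<union> {}) f \<in> Y"
      using fork_closed[OF Y t(1)] tr Top by simp
    then show ?thesis by (rule replace) (auto simp: wc intro: srkam.refl V)
  next
    case One
    show ?thesis
    proof (cases xs rule: rev_cases)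
      case (snoc zs z)
      let ?t = "stack (ks @ zs) z"
      have "stack zs (z \<star> One) \<leadsto> stack zs z" by (intro stack_step trans_step.comp_one)
      then have step: "t \<leadsto> ?t" unfolding tr One snoc
        by (simp add: stack_step)
      have R': "set zs \<subseteq> RegE \<Sigma>" "z \<in> RegE \<Sigma>" using R snoc by auto
      have "V \<sqsubseteq> stack (b # zs) (z \<star> One)" using Vr One snoc by simp
      also have "\<dots> \<sqsubseteq> stack (b # zs) z"
        using R R' by (intro stack_mono srkam.comp_one_le) auto
      finally have "tracks A V ?t (weight (stack zs z))"
        unfolding tracks_def using b token
        by (intro exI[of _ ks] exI[of _ b] exI[of _ "stack zs z"]) auto
      \<comment> \<open>Popping removes the factor \<open>weight One = 2\<close>.\<close>
      moreover have "weight (stack zs z) < \<omega> t"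
        by (simp add: wc c snoc One weight_stack)
      ultimately show ?thesis
        using tr One by (intro replace1[OF Y step _ srkam.refl[OF V]]) auto
    next
      case Nil
      then have t1: "t = stack ks One" using tr One by simp
      \<comment> \<open>The part to be played is used up although \<open>t\<close> is not
        \<open>One\<close>, so there is a token, and it surfaces now.\<close>
      then have "ks \<noteq> []" using t(2) by auto
      then obtain s where s: "s \<in> states" "s \<notin> A" "knows b s" using token by auto
      obtain zs z where zs: "ks = zs @ [z]" using \<open>ks \<noteq> []\<close> by (metis rev_exhaust)
      let ?t = "stack zs z"
      have "t \<leadsto> ?t" unfolding t1 zs by (simp add: stack_step trans_step.comp_one)
      then have Y': "Pos \<Gamma> (X - {t} \<union> {?t}) f \<in> Y"
        using Y t t1 by (intro explore_closed) auto
      have "b \<star> One \<sqsubseteq> b" using R by (intro srkam.comp_one_le)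
      with Vr[unfolded One Nil] have Vb: "V \<sqsubseteq> b" by (simp add: srkam.trans[of _ V "b \<star> One"])
      have "V \<sqsubseteq> t'" if t': "t' \<in> X - {t} \<union> {?t}" for t'
      proof (cases "t' \<in> X")
        case True
        then show ?thesis
          using S Y_RegE(2)[OF Y] by (auto simp: supports_def intro: tracks_leq)
      next
        case False
        note Vb
        also note b
        also have "stack ks One \<sqsubseteq> ?t"
          using R(1) unfolding zs by (auto intro: stack_mono srkam.comp_one_le)
        finally show ?thesis using t' False by auto
      qed
      then have "supports (insert s A) V \<Gamma> (X - {t} \<union> {?t}) weight"
        using S s(3) Vb by (auto simp: supports_def intro: tracks_refl knows_mono)
      then show ?thesis using s A Y' by (intro more_knowledge[of "insert s A"]) auto
    qed
  next
    case (Join u v)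
    have R': "u \<in> RegE \<Sigma>" "v \<in> RegE \<Sigma>" using R Join by auto
    have "V \<sqinter> stack (b # xs) u \<sqsubseteq> f" "V \<sqinter> stack (b # xs) v \<sqsubseteq> f"
      using R' Join by (auto intro!: advance[OF Y] intro: trans_step.intros simp del: foldr.simps)
    with srkam.trans[OF Vr[unfolded Join] stack_join[OF bxs R']]
    show ?thesis by (rule leq_join_cases)
  next
    case (Meet u v)
    have R': "u \<in> RegE \<Sigma>" "v \<in> RegE \<Sigma>" using R Meet by auto
    note Vr = Vr[unfolded Meet]
    have sub: "V \<sqsubseteq> stack (b # xs) u" "V \<sqsubseteq> stack (b # xs) v"
      using srkam.trans[OF Vr stack_mono[OF bxs srkam.meet_lower1[OF R']]]
        srkam.trans[OF Vr stack_mono[OF bxs srkam.meet_lower2[OF R']]] by blast+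
    let ?C = "{stack (ks @ xs) u, stack (ks @ xs) v}"
    have "{t'. t \<leadsto> t'} = ?C"
      unfolding tr using stack_step_iff[of r "ks @ xs"] r Meet
      by (auto elim!: trans_stepE intro: trans_step.intros)
    then have Y': "Pos \<Gamma> (X - {t} \<union> ?C) f \<in> Y"
      using fork_closed[OF Y t(1)] tr Meet by simp
    define n where "n y = (if y = stack (ks @ xs) u then P * weight u else P * weight v)" for y
    \<comment> \<open>Only an inequality, since the two branches may be the same thread.\<close>
    have "sum n ?C \<le> P * weight u + P * weight v"
      by (cases "stack (ks @ xs) u = stack (ks @ xs) v") (auto simp: n_def)
    also have "\<dots> < \<omega> t" using P by (simp add: wc c Meet weight_stack P_def algebra_simps)
    finally have less: "sum n ?C < \<omega> t" .
    have "tracks A V t' (n t')" if "t' \<in> ?C" for t'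
      using that tracks_same[OF sub(1)] tracks_same[OF sub(2)] by (auto simp: n_def)
    then show ?thesis using less by (intro replace[OF Y' srkam.refl[OF V]]) auto
  next
    case (Comp x y)
    then show ?thesis using r by blast
  next
    case (Dia d)
    \<comment> \<open>A return to a known state closes the proof without unfolding.\<close>
    show ?thesis
    proof (cases "(\<Gamma>, X) \<in> A")
      case True
      then show ?thesis using S Y by (auto simp: supports_def knows_def)
    next
      case False
      have s: "(\<Gamma>, X) \<in> states - A" using False Y_bounded[OF Y] by (auto simp: states_def)
      have d: "d \<in> RegE \<Sigma>" using R Dia by simp
      have "finite {f'. Pos \<Gamma> X f' \<in> Y}" "{f'. Pos \<Gamma> X f' \<in> Y} \<subseteq> RegE \<Sigma>"
        using finite_subset[OF _ finite_E, of "{f'. Pos \<Gamma> X f' \<in> Y}"] Y_bounded[of \<Gamma> X] E_RegE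
        by auto
      then obtain m where m: "m \<in> RegE \<Sigma>" "\<And>f'. Pos \<Gamma> X f' \<in> Y \<Longrightarrow> m \<sqsubseteq> f'"
        "\<And>v. v \<in> RegE \<Sigma> \<Longrightarrow> (\<And>f'. Pos \<Gamma> X f' \<in> Y \<Longrightarrow> v \<sqsubseteq> f') \<Longrightarrow> v \<sqsubseteq> m"
        by (rule finite_meet_exists) auto
      \<comment> \<open>The component \<open>m\<close> gives knowledge of the current state; the
        component \<open>t\<close> keeps \<open>b'\<close> below the pending prefix, as a token has
        to be.\<close>
      define b' where "b' = m \<sqinter> t"
      have b'R: "b' \<in> RegE \<Sigma>" using m tR by (simp add: b'_def)
      have b't: "b' \<sqsubseteq> t" using m tR unfolding b'_def by (intro srkam.meet_lower2)
      have b'm: "b' \<sqsubseteq> m" using m tR unfolding b'_def by (intro srkam.meet_lower1)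
      have knows: "knows b' (\<Gamma>, X)"
        using b'm m(2) by (auto simp: knows_def intro: srkam.trans)
      have Vt: "V \<sqsubseteq> t" using S t(1) tR by (auto simp: supports_def intro: tracks_leq)
      let ?y = "stack (b # xs) One"
      have y: "?y \<in> RegE \<Sigma>" using R by simp
      have "V \<sqsubseteq> ?y \<star> d\<^sup>\<diamond>"
        using srkam.trans[OF Vr[unfolded Dia] stack_assoc1[OF bxs]] d by simp
      \<comment> \<open>Base case: the iteration is left by
        \<open>d\<^sup>\<diamond> \<leadsto> One\<close>.\<close>
      moreover have "V \<sqinter> ?y \<sqsubseteq> b'"
        unfolding b'_def
      proof (rule srkam.meet_greatest)
        have Vy: "V \<sqinter> ?y \<sqsubseteq> V" using V y by (rule srkam.meet_lower1)
        then show "V \<sqinter> ?y \<sqsubseteq> t" using Vt by (rule srkam.trans)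
        have "V \<sqinter> ?y \<sqsubseteq> f'" if "Pos \<Gamma> X f' \<in> Y" for f'
          using that by (rule advance) (auto simp: Dia intro: trans_step.intros)
        then show "V \<sqinter> ?y \<sqsubseteq> m" using leq_RegE[OF Vy] by (intro m(3)) auto
      qed
      \<comment> \<open>One more round, by
        \<open>d\<^sup>\<diamond> \<leadsto> d\<^sup>\<diamond> \<star> d\<close>. The new token
        \<open>b'\<close> covers the whole prefix up to \<open>d\<^sup>\<diamond>\<close>, including
        whatever the old token covered, so only \<open>weight d\<close> is counted.\<close>
      moreover have "V \<sqinter> (b' \<star> d) \<sqsubseteq> b'"
      proof -
        have bd: "b' \<star> d \<in> RegE \<Sigma>" using b'R d by simp
        let ?V = "V \<sqinter> (b' \<star> d)"
        have VV: "?V \<sqsubseteq> V" using V bd by (rule srkam.meet_lower1)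
        let ?t = "stack (ks @ xs @ [d\<^sup>\<diamond>]) d"
        have step: "t \<leadsto> ?t"
          using stack_step[OF trans_step.dia_more, of "ks @ xs"] unfolding tr Dia by simp
        note b't
        also have "t \<sqsubseteq> stack (ks @ xs @ [d\<^sup>\<diamond>]) One"
          using R d unfolding tr Dia by (auto intro!: stack_mono srkam.le_comp_one)
        finally have tracks: "tracks A ?V ?t (weight d)"
          unfolding tracks_def using srkam.meet_lower2[OF V bd] s knows
          by (intro exI[of _ "ks @ xs @ [d\<^sup>\<diamond>]"] exI[of _ b'] exI[of _ d]) auto
        have "weight d < P * (weight d + 2)" using P by (cases P) auto
        then have less: "weight d < \<omega> t" by (simp add: wc c Dia weight_stack P_def)
        have "pol t = PExists" by (simp add: tr Dia)
        then have "?V \<sqsubseteq> f'" if "Pos \<Gamma> X f' \<in> Y" for f'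
          using replace1[OF that step _ VV tracks less] by blast
        then have "?V \<sqsubseteq> m" using V bd by (intro m(3)) auto
        then show ?thesis
          using srkam.trans[OF VV Vt] unfolding b'_def by (rule srkam.meet_greatest)
      qed
      ultimately have "V \<sqsubseteq> b'" by (rule leq_dia_cases)
      also note b'm
      also have "m \<sqsubseteq> f" using Y by (rule m(2))
      finally show ?thesis .
    qed
  qed
qed

text \<open>Induction on the attractor: Alea, Choose and Junk keep the left-hand state and the bound
  \<open>V\<close>. Only Fill changes them, and there a letter of a thread is consumed, which lowers
  the weight.\<close>

lemma settled_leq:
  assumes less_weight: "\<And>\<Gamma>' X' f' V' \<omega>'. sum \<omega>' X' < sum \<omega> X \<Longrightarrow> Pos \<Gamma>' X' f' \<in> Y \<Longrightarrow>
      supports A V' \<Gamma>' X' \<omega>' \<Longrightarrow> V' \<sqsubseteq> f'"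
    and S: "supports A V \<Gamma> X \<omega>" and X: "settled X" "finite X"
    and f: "attracted Y \<Gamma> X f" "f \<in> RegE \<Sigma>"
  shows "V \<sqsubseteq> f"
  using f
proof (induction rule: attracted.induct)
  case (left f)
  then show ?case using X by simp
next
  case (alea f)
  have V: "V \<in> RegE \<Sigma>" using S by (simp add: supports_def)
  obtain hs r where h: "f = stack hs r" and r: "\<And>x y. r \<noteq> x \<star> y" by (rule stack_decomp) blast
  have R: "set hs \<subseteq> RegE \<Sigma>" "r \<in> RegE \<Sigma>" using alea.prems h by auto
  show ?case
  proof (cases r)
    case Top
    have "V \<sqsubseteq> Top" using V by (rule srkam.le_top)
    also have "\<dots> \<sqsubseteq> f" unfolding h Top using R(1) by (rule stack_top)
    finally show ?thesis .
  next
    case (Meet u v)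
    have R': "u \<in> RegE \<Sigma>" "v \<in> RegE \<Sigma>" using R Meet by auto
    have "V \<sqsubseteq> stack hs u" "V \<sqsubseteq> stack hs v"
      using R R' h Meet by (auto intro!: alea.IH stack_step intro: trans_step.intros)
    then have "V \<sqsubseteq> stack hs u \<sqinter> stack hs v" by (rule srkam.meet_greatest)
    also have "\<dots> \<sqsubseteq> f" unfolding h Meet using R(1) R' by (rule stack_meet)
    finally show ?thesis .
  qed (use alea.hyps h r in auto)
next
  case (choose f f')
  have "f' \<sqsubseteq> f" using choose.hyps choose.prems by (intro exists_step_leq)
  then show ?case using choose.IH by (meson leq_RegE(1) srkam.trans)
next
  case (junk f a f')
  have V: "V \<in> RegE \<Sigma>" using S by (simp add: supports_def)
  obtain hs where h: "f = stack hs (Letter a)" "f' = stack hs One"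
    using junk.hyps by (auto elim: letter_step)
  have R: "set hs \<subseteq> RegE \<Sigma>" "a \<in> \<Sigma>" using junk.prems h by auto
  have "V \<sqsubseteq> Top \<star> Letter a" using S junk.hyps by (simp add: supports_def)
  \<comment> \<open>\<open>V\<close> itself now bounds the part before the last letter, so the
    induction hypothesis for \<open>f'\<close> applies to that part.\<close>
  then have "V \<sqsubseteq> (V \<sqinter> Top) \<star> Letter a" by (rule leq_meet_comp)
  also have "\<dots> \<sqsubseteq> f' \<star> Letter a"
  proof (rule srkam.comp_mono)
    have "V \<sqinter> Top \<sqsubseteq> V" using V by (intro srkam.meet_lower1) auto
    also have "V \<sqsubseteq> f'" using R h by (intro junk.IH) auto
    finally show "V \<sqinter> Top \<sqsubseteq> f'" .
  qed (use R in \<open>auto intro: srkam.refl\<close>)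
  also have "\<dots> \<sqsubseteq> f" using R unfolding h by (intro stack_assoc2) auto
  finally show ?case .
next
  case (fill f a t f' t')
  have V: "V \<in> RegE \<Sigma>" using S by (simp add: supports_def)
  obtain hs where h: "f = stack hs (Letter a)" "f' = stack hs One"
    using fill.hyps by (auto elim: letter_step)
  have R: "set hs \<subseteq> RegE \<Sigma>" "a \<in> \<Sigma>" using fill.prems h by auto
  obtain ks b c where ks: "t = stack ks c" and Vc: "V \<sqsubseteq> b \<star> c" and b: "b \<sqsubseteq> stack ks One"
    and wc: "\<omega> t = weight c" and token: "ks = [] \<or> (\<exists>s \<in> states - A. knows b s)"
    using S fill.hyps unfolding supports_def tracks_def by blast
  obtain xs where c: "c = stack xs (Letter a)" and t': "t' = stack (ks @ xs) One"
  proof -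
    obtain xs r where c: "c = stack xs r" and r: "\<And>x y. r \<noteq> x \<star> y" by (rule stack_decomp) blast
    have "r = Letter a" using fill.hyps ks c r by (cases r) auto
    moreover have "t' = stack (ks @ xs) One"
      using fill.hyps(6) stack_step_iff[of r "ks @ xs"] calculation unfolding ks c
      by (auto elim!: trans_stepE)
    ultimately show ?thesis using c that by blast
  qed
  have bxs: "set (b # xs) \<subseteq> RegE \<Sigma>" using leq_RegE[OF b] leq_RegE[OF Vc] c by auto
  \<comment> \<open>What remains of the thread before its last letter; \<open>V \<sqinter> y\<close>
    is the bound after reading that letter.\<close>
  define y where "y = stack (b # xs) One"
  have y: "y \<in> RegE \<Sigma>" using bxs by (simp add: y_def)
  have "V \<sqsubseteq> stack (b # xs) (Letter a)" using Vc c by simp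
  also have "\<dots> \<sqsubseteq> y \<star> Letter a" unfolding y_def using bxs R by (intro stack_assoc1) auto
  finally have Vy: "V \<sqsubseteq> y \<star> Letter a" .
  have Vy_V: "V \<sqinter> y \<sqsubseteq> V" using V y by (rule srkam.meet_lower1)
  have Va: "V \<sqsubseteq> Top \<star> Letter a"
    using srkam.trans[OF Vy comp_mono_left[OF srkam.le_top[OF y]]] R by simp
  have "tracks A (V \<sqinter> y) t' (weight (stack xs One))"
    unfolding tracks_def t' using b token srkam.meet_lower2[OF V y]
    by (intro exI[of _ ks] exI[of _ b] exI[of _ "stack xs One"]) (auto simp: y_def)
  moreover have "weight (stack xs One) < \<omega> t" by (simp add: wc c weight_stack)
  ultimately obtain \<omega>' where "supports A (V \<sqinter> y) \<Gamma> (X - {t} \<union> {t'}) \<omega>'"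
    and less: "sum \<omega>' (X - {t} \<union> {t'}) < sum \<omega> X"
    using supports_step[OF S fill.hyps(3) Vy_V X(2), of "{t'}" "\<lambda>_. weight (stack xs One)"]
    by auto
  then have "supports A (V \<sqinter> y) (\<Gamma> \<union> {a}) (X - {t} \<union> {t'}) \<omega>'"
    using srkam.trans[OF Vy_V Va] by (auto simp: supports_def)
  with less fill.hyps have "V \<sqinter> y \<sqsubseteq> f'" by (intro less_weight)
  then have "(V \<sqinter> y) \<star> Letter a \<sqsubseteq> f' \<star> Letter a"
    using R by (auto intro!: comp_mono_left comp_mono_right)
  also have "\<dots> \<sqsubseteq> f" using R unfolding h by (intro stack_assoc2) auto
  finally show ?case using leq_meet_comp[OF Vy] by (rule srkam.trans[rotated])
qed

text \<open>Outer induction on the number of unknown states, inner induction on the total weight;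
  the weight may grow whenever knowledge does.\<close>

lemma supports_leq:
  assumes "A \<subseteq> states" "Pos \<Gamma> X f \<in> Y" "supports A V \<Gamma> X \<omega>"
  shows "V \<sqsubseteq> f"
  using assms
proof (induction "card (states - A)" arbitrary: A \<Gamma> X f V \<omega> rule: less_induct)
  case (less A)
  have IH: "V \<sqsubseteq> f" if "A \<subset> A'" "A' \<subseteq> states" "Pos \<Gamma> X f \<in> Y" "supports A' V \<Gamma> X \<omega>"
    for A' \<Gamma> X f V \<omega>
    using that finite_states less.hyps[of A' \<Gamma> X f V \<omega>] by (auto intro: psubset_card_mono)
  from less.prems(2,3) show ?case
  proof (induction "sum \<omega> X" arbitrary: \<Gamma> X f V \<omega> rule: less_induct)
    case (less X \<omega>)
    show ?case
    proof (cases "settled X")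
      case True
      then show ?thesis
        using less Y_finite Y_RegE Y_attracted by (intro settled_leq[of \<omega> X A V \<Gamma>]) auto
    next
      case False
      then obtain t where t: "t \<in> X" "t \<noteq> One" "pol t \<in> {PExists, PForall}"
        by (auto simp: settled_def)
      show ?thesis
        by (rule unsettled_leq[OF _ _ \<open>A \<subseteq> states\<close> less.prems t]) (rule IH less.hyps; assumption)+
    qed
  qed
qed

lemma single_thread_leq:
  assumes "Pos {} {e} f \<in> Y"
  shows "e \<sqsubseteq> f"
proof -
  have "e \<in> RegE \<Sigma>" using Y_RegE(2)[OF assms] by simp
  then have "supports {} e {} {e} weight"
    by (auto simp: supports_def intro: tracks_refl srkam.refl)
  then show ?thesis using assms by (intro supports_leq[of "{}"]) auto
qed

end

section \<open>Plays conforming to a winning strategy\<close>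

lemma not_settled_pol: "\<not> settled X \<Longrightarrow> position_pol (Pos \<Gamma> X f) = PForall"
  by (auto simp: settled_def)

lemma settled_pol:
  "settled X \<Longrightarrow> position_pol (Pos \<Gamma> X f) = (if pol f = PForall then PForall else PExists)"
  by (cases "pol f") (auto simp: settled_def)

text \<open>Choose and Junk need polarity \<open>PExists\<close>; an available Alea move is excluded
  in winning positions. This turns the Buechi condition into well-foundedness.\<close>

lemma right_move_not_winning:
  assumes "move k p q" "k \<in> {Alea, Choose, Junk}"
  shows "\<not> winning_position p"
  using assms(1)
proof cases
  case alea
  then show ?thesis using assms(1) by (auto simp: winning_position_def)
qed (use assms(2) in \<open>auto simp: winning_position_def\<close>)

lemma finite_play_snoc:
  "finite_play \<Sigma> p (h @ [q]) \<longleftrightarrow>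
    (if h = [] then q = p else finite_play \<Sigma> p h \<and> game_move \<Sigma> (last h) q)"
  by (auto simp: finite_play_def successively_append_iff)

lemma finite_play_derivatives:
  assumes "finite_play \<Sigma> (Pos {} {e} f) h" "last h = Pos \<Gamma> X g"
  shows "X \<subseteq> {t. trans_step\<^sup>*\<^sup>* e t}" "g \<in> {t. trans_step\<^sup>*\<^sup>* f t}"
proof -
  have "X \<subseteq> {t. trans_step\<^sup>*\<^sup>* e t} \<and> g \<in> {t. trans_step\<^sup>*\<^sup>* f t}"
    using assms
  proof (induction h arbitrary: \<Gamma> X g rule: rev_induct)
    case Nil
    then show ?case by (simp add: finite_play_def)
  next
    case (snoc q h)
    show ?case
    proof (cases "h = []")
      case True
      then show ?thesis using snoc.prems by (auto simp: finite_play_def)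
    next
      case False
      then have h: "finite_play \<Sigma> (Pos {} {e} f) h" "game_move \<Sigma> (last h) (Pos \<Gamma> X g)"
        using snoc.prems by (auto simp: finite_play_snoc)
      then obtain k where k: "move k (last h) (Pos \<Gamma> X g)" by (auto simp: game_move_def)
      obtain \<Gamma>' X' g' where l: "last h = Pos \<Gamma>' X' g'" by (cases "last h")
      have "X' \<subseteq> {t. trans_step\<^sup>*\<^sup>* e t} \<and> g' \<in> {t. trans_step\<^sup>*\<^sup>* f t}"
        using snoc.IH[OF h(1) l] .
      with k[unfolded l] show ?thesis by cases (auto intro: rtranclp.rtrancl_into_rtrancl)
    qed
  qed
  then show "X \<subseteq> {t. trans_step\<^sup>*\<^sup>* e t}" "g \<in> {t. trans_step\<^sup>*\<^sup>* f t}" by auto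
qed

locale winning_strategy =
  fixes \<Sigma> :: "'a set" and p :: "'a position" and \<sigma> :: "'a position list \<Rightarrow> 'a position"
  assumes initial: "p \<in> positions \<Sigma>" and wins: "duplicator_winning_strategy \<Sigma> p \<sigma>"
begin

definition plays :: "'a position list set" where
  "plays = {h. finite_play \<Sigma> p h \<and> finite_conforms \<sigma> h}"

lemma plays_positions:
  assumes "h \<in> plays"
  shows "last h \<in> positions \<Sigma>"
proof (cases h rule: rev_cases)
  case Nil
  then show ?thesis using assms by (simp add: plays_def finite_play_def)
next
  case (snoc h' q)
  then show ?thesis
    using assms initial
    by (auto simp: plays_def finite_play_snoc game_move_def split: if_splits)
qed

lemma plays_extend:
  assumes h: "h \<in> plays" and m: "move k (last h) q"
    and \<sigma>: "position_pol (last h) = PExists \<Longrightarrow> q = \<sigma> h"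
  shows "h @ [q] \<in> plays"
proof -
  have ne: "h \<noteq> []" using h by (auto simp: plays_def finite_play_def)
  have "game_move \<Sigma> (last h) q"
    using m plays_positions[OF h] move_positions[OF m] by (auto simp: game_move_def)
  then have "finite_play \<Sigma> p (h @ [q])" using h ne by (simp add: plays_def finite_play_snoc)
  moreover have "finite_conforms \<sigma> (h @ [q])"
    unfolding finite_conforms_def
  proof (intro allI impI)
    fix n
    assume n: "Suc n < length (h @ [q])" "position_pol ((h @ [q]) ! n) = PExists"
    show "(h @ [q]) ! Suc n = \<sigma> (take (Suc n) (h @ [q]))"
    proof (cases "Suc n = length h")
      case True
      then have "h ! n = last h" using ne by (simp add: last_conv_nth flip: True)
      then show ?thesis using True n \<sigma> by (simp add: nth_append)
    next
      case False
      then show ?thesis using h n by (auto simp: plays_def finite_conforms_def nth_append)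
    qed
  qed
  ultimately show ?thesis by (simp add: plays_def)
qed

text \<open>On histories, since \<open>\<sigma>\<close> need not be positional. Fill is left out
  because it changes the left-hand state.\<close>

definition right_moves :: "('a position list \<times> 'a position list) set" where
  "right_moves = {(h @ [q], h) | h q. h \<in> plays \<and> h @ [q] \<in> plays \<and>
    (\<exists>k \<in> {Alea, Choose, Junk}. move k (last h) q)}"

text \<open>An infinite chain would be a conforming infinite play that, from some point on, visits
  no winning position.\<close>

lemma wf_right_moves: "wf right_moves"
  unfolding wf_iff_no_infinite_down_chain
proof
  assume "\<exists>F. \<forall>i. (F (Suc i), F i) \<in> right_moves"
  then obtain F where F: "\<And>i. (F (Suc i), F i) \<in> right_moves" by blast
  have plays: "F i \<in> plays" for i using F[of i] by (auto simp: right_moves_def)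
  have ne: "F i \<noteq> []" for i using plays[of i] by (auto simp: plays_def finite_play_def)
  have snoc: "\<exists>q. F (Suc i) = F i @ [q]" for i using F[of i] by (auto simp: right_moves_def)
  have len: "length (F i) = length (F 0) + i" for i
  proof (induction i)
    case (Suc i)
    then show ?case using snoc[of i] by auto
  qed simp
  have pos: "0 < length (F 0)" using ne by simp
  have nth: "F j ! n = F i ! n" if "i \<le> j" "n < length (F i)" for i j n
    using that
  proof (induction j rule: dec_induct)
    case (step j)
    then show ?case using snoc[of j] len[of i] len[of j] by (auto simp: nth_append)
  qed simp
  \<comment> \<open>The limit of the growing histories; \<open>F n\<close> is long enough because
    \<open>F 0\<close> is nonempty.\<close>
  define \<pi> where "\<pi> n = F n ! n" for n
  have \<pi>: "F j ! n = \<pi> n" if "n \<le> j" for j n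
    using nth[OF that, of n] len[of n] pos by (simp add: \<pi>_def)
  have "infinite_play \<Sigma> p \<pi>"
    unfolding infinite_play_def
  proof (intro conjI allI)
    show "\<pi> 0 = p"
      using plays[of 0] by (auto simp: \<pi>_def plays_def finite_play_def hd_conv_nth)
    fix n
    have "successively (game_move \<Sigma>) (F (Suc n))"
      using plays[of "Suc n"] by (auto simp: plays_def finite_play_def)
    then have "game_move \<Sigma> (F (Suc n) ! n) (F (Suc n) ! Suc n)"
      using len[of "Suc n"] pos by (auto simp: successively_conv_nth)
    then show "game_move \<Sigma> (\<pi> n) (\<pi> (Suc n))" by (simp add: \<pi>)
  qed
  moreover have "infinite_conforms \<sigma> \<pi>"
    unfolding infinite_conforms_def
  proof (intro allI impI)
    fix n assume n: "position_pol (\<pi> n) = PExists"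
    have l: "Suc n < length (F (Suc n))" using len[of "Suc n"] pos by simp
    have "take (Suc n) (F (Suc n)) = map \<pi> [0..<Suc n]"
    proof (rule nth_equalityI)
      fix i assume "i < length (take (Suc n) (F (Suc n)))"
      then have "i \<le> n" by simp
      then show "take (Suc n) (F (Suc n)) ! i = map \<pi> [0..<Suc n] ! i"
        using \<pi>[of i "Suc n"] by (simp del: upt_Suc)
    qed (use l in simp)
    then show "\<pi> (Suc n) = \<sigma> (map \<pi> [0..<Suc n])"
      using plays[of "Suc n"] l n \<pi>[of n "Suc n"] \<pi>[of "Suc n" "Suc n"]
      by (simp add: plays_def finite_conforms_def del: upt_Suc)
  qed
  ultimately have "\<exists>\<^sub>\<infinity>n. winning_position (\<pi> n)"
    using wins by (simp add: duplicator_winning_strategy_def)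
  then obtain n where n: "length (F 0) \<le> n" "winning_position (\<pi> n)"
    by (auto simp: cofinite_eq_sequentially frequently_sequentially)
  \<comment> \<open>Chosen so that \<open>F i\<close> ends exactly at \<open>\<pi> n\<close>, from
    which the chain makes a right-hand move.\<close>
  define i where "i = Suc n - length (F 0)"
  have "length (F i) = Suc n" using n(1) len[of i] by (simp add: i_def)
  moreover have "i \<le> n" using pos unfolding i_def by arith
  ultimately have "last (F i) = \<pi> n" using nth[of i n n] ne by (simp add: last_conv_nth \<pi>_def)
  moreover have "\<not> winning_position (last (F i))"
    using F[of i] right_move_not_winning by (auto simp: right_moves_def)
  ultimately show False using n(2) by simp
qed

text \<open>Well-founded induction along \<open>right_moves\<close>. Where Spoiler moves, every
  successor extends the play; where Duplicator moves, \<open>\<sigma> h\<close> does. Left-hand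
  moves and Fill end the induction.\<close>

lemma plays_attracted:
  assumes "h \<in> plays" "last h = Pos \<Gamma> X f"
  shows "attracted (last ` plays) \<Gamma> X f"
  using wf_right_moves assms
proof (induction h arbitrary: f rule: wf_induct_rule)
  case (less h)
  have extend: "q \<in> last ` plays"
    if "move k (Pos \<Gamma> X f) q" "position_pol (Pos \<Gamma> X f) = PExists \<Longrightarrow> q = \<sigma> h" for k q
    using plays_extend[OF less.prems(1), of k q] that less.prems(2)
    by (metis image_eqI last_snoc)
  have IH: "attracted (last ` plays) \<Gamma> X f'"
    if "move k (Pos \<Gamma> X f) (Pos \<Gamma> X f')" "k \<in> {Alea, Choose, Junk}"
      "position_pol (Pos \<Gamma> X f) = PExists \<Longrightarrow> Pos \<Gamma> X f' = \<sigma> h" for k f'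
  proof -
    have e: "h @ [Pos \<Gamma> X f'] \<in> plays"
      using plays_extend[OF less.prems(1), of k] that(1,3) less.prems(2) by simp
    then have "(h @ [Pos \<Gamma> X f'], h) \<in> right_moves"
      using less.prems that(1,2) unfolding right_moves_def by auto
    then show ?thesis using e by (rule less.IH) simp
  qed
  show ?case
  proof (cases "settled X")
    case False
    show ?thesis
    proof (rule attracted.left[OF False])
      show "q \<in> last ` plays" if "move k (Pos \<Gamma> X f) q" for k q
        using that by (rule extend) (simp only: not_settled_pol[OF False] polarity.distinct)
    qed
  next
    case X: True
    show ?thesis
    proof (cases "pol f = PForall")
      case True
      show ?thesis
      proof (rule attracted.alea[OF X True])
        fix f' assume "f \<leadsto> f'"
        with True X have "move Alea (Pos \<Gamma> X f) (Pos \<Gamma> X f')"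
          unfolding settled_def by (intro move.alea)
        moreover have "position_pol (Pos \<Gamma> X f) \<noteq> PExists"
          unfolding settled_pol[OF X] using True by simp
        ultimately show "attracted (last ` plays) \<Gamma> X f'" by (intro IH[of Alea]) blast+
      qed
    next
      case False
      have pp: "position_pol (last h) = PExists"
        unfolding less.prems(2) settled_pol[OF X] using False by simp
      \<comment> \<open>A conforming play cannot be maximal here, so a move exists and
        \<open>\<sigma>\<close> must pick a legal one.\<close>
      then have "\<not> winning_position (last h)" by (simp add: winning_position_def)
      then have "\<exists>q. game_move \<Sigma> (last h) q"
        using wins less.prems(1)
        unfolding duplicator_winning_strategy_def maximal_finite_play_def plays_def by blast
      then have "game_move \<Sigma> (last h) (\<sigma> h)"
        using wins less.prems(1) pp
        unfolding duplicator_winning_strategy_def duplicator_strategy_def plays_def by blast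
      then obtain k where k: "move k (Pos \<Gamma> X f) (\<sigma> h)"
        unfolding less.prems(2) game_move_def by blast
      \<comment> \<open>This rules out left-hand moves: \<open>One\<close> has no step, and its
        polarity forbids Fork.\<close>
      have One: "t = One" if "t \<in> X" "pol t = PExists \<or> pol t = PForall" for t
        using X that unfolding settled_def by blast
      from k show ?thesis
      proof cases
        case (explore t X' t')
        then have "t = One" by (intro One) blast+
        then show ?thesis using explore(6) by (blast elim: trans_stepE)
      next
        case (fork t X')
        then have "t = One" by (intro One) blast+
        then show ?thesis using fork(5) by simp
      next
        case alea
        then show ?thesis using False by simp
      next
        case (choose f')
        have "attracted (last ` plays) \<Gamma> X f'"
          using k unfolding choose(1,2) by (rule IH) (simp_all add: choose(2))
        then show ?thesis by (rule attracted.choose[OF X choose(4,5)])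
      next
        case (junk a f')
        have "attracted (last ` plays) \<Gamma> X f'"
          using k unfolding junk(1,2) by (rule IH) (simp_all add: junk(2))
        then show ?thesis by (rule attracted.junk[OF X junk(4-6)])
      next
        case (fill t X' a f' t')
        have "t \<in> X" "X - {t} = X'" using fill(2,4) by blast+
        then show ?thesis
          using extend[OF k] fill(3)
          by (intro attracted.fill[OF X fill(6) _ fill(7-9)]) simp_all
      qed
    qed
  qed
qed

end

theorem theorem4p1:
  fixes \<Sigma> :: "'a set" and e f :: "'a expr"
  assumes "finite \<Sigma>"
    and "e \<in> RegE \<Sigma>" and "f \<in> RegE \<Sigma>"
    and "\<exists>\<sigma>. duplicator_winning_strategy \<Sigma> (Pos {} {e} f) \<sigma>"
  shows "srkam \<Sigma> e f"
proof -
  let ?p = "Pos {} {e} f"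
  obtain \<sigma> where \<sigma>: "duplicator_winning_strategy \<Sigma> ?p \<sigma>" using assms(4) by blast
  interpret winning_strategy \<Sigma> ?p \<sigma>
    using assms(2,3) \<sigma> by unfold_locales (auto simp: positions_def)
  \<comment> \<open>The final positions of conforming plays form a winning region, bounded by the
    derivatives of \<open>e\<close> and \<open>f\<close>.\<close>
  interpret winning_region \<Sigma> "last ` plays" "{t. trans_step\<^sup>*\<^sup>* e t}" "{t. trans_step\<^sup>*\<^sup>* f t}"
  proof unfold_locales
    fix \<Gamma> X g
    assume "Pos \<Gamma> X g \<in> last ` plays"
    then obtain h where h: "h \<in> plays" "last h = Pos \<Gamma> X g" by auto
    show "attracted (last ` plays) \<Gamma> X g" using h by (rule plays_attracted)
    show "\<Gamma> \<subseteq> \<Sigma> \<and> X \<subseteq> {t. trans_step\<^sup>*\<^sup>* e t} \<and> g \<in> {t. trans_step\<^sup>*\<^sup>* f t}"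
      using plays_positions[OF h(1)] finite_play_derivatives[OF _ h(2)] h
      by (auto simp: plays_def positions_def)
  qed (use assms finite_derivatives derivatives_RegE in auto)
  have "[?p] \<in> plays" by (simp add: plays_def finite_play_def finite_conforms_def)
  then have "?p \<in> last ` plays" by (metis image_eqI last.simps)
  then show ?thesis by (rule single_thread_leq)
qed

end
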